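(* Let $k\ge 3$ and $n\ge k$ be integers, and let $U_1,\dots,U_n$ be independent random variables, each uniformly distributed on $[0,1]$. Let $P_n^{(k)}$ be the probability that no $k+1$ of the numbers $U_1,\dots,U_n$ can form a $(k+1)$-gon. Then $$P_n^{(k)}=\prod_{l=1}^{n-k+2}\frac{1}{F_k^{l}}\;\prod_{i=1}^{k-2}\frac{1}{F_k^{\,n-i+1}-\sum_{j=1}^{k-i-1}(k-i-j)\,F_k^{\,n-k+j}},$$ where $F_k^l$ is the $l$-th term of the $k$-step Fibonacci-type recurrence.
   Context: Superscripts on $F_k$ are indices, not powers. For a fixed integer $k\ge 2$, the $k$-step Fibonacci-type recurrence is the sequence $\{F_k^{l}\}_{l\ge 2-k}$ defined by $F_k^{1}=1$, $F_k^{0}=F_k^{-1}=\dots=F_k^{2-k}=0$, and $F_k^{l}=\sum_{j=1}^{k}F_k^{l-j}$ for $l\ge 2$. Numbers $a_1,\dots,a_{k+1}\in[0,1]$ "can form a $(k+1)$-gon" if they can be the side lengths of a (nondegenerate) $(k+1)$-gon, i.e. if the largest of them is strictly less than the sum of the other $k$. Thus the event in question is that, for every choice of $k+1$ distinct indices from $\{1,\dots,n\}$, the largest of the corresponding $U_i$ is at least the sum of the other $k$. *)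

theory Defs
  imports "HOL-Probability.Probability"
begin

text \<open>
  The \<open>k\<close>-step Fibonacci recurrence \<open>F\<^sub>k\<^sup>l\<close>. The index ranges over the integers, so that
  \<open>l - j\<close> is a genuine subtraction; the mathematical domain is \<open>l \<ge> 2 - k\<close>, and only values
  at such indices enter the recurrence for \<open>l \<ge> 2\<close>.
\<close>

function kfib :: "nat \<Rightarrow> int \<Rightarrow> nat" where
  "kfib k l =
     (if l \<le> 0 then 0 else if l = 1 then 1 else (\<Sum>j\<in>{1..k}. kfib k (l - int j)))"
  by pat_completeness auto
termination
  by (relation "Wellfounded.measure (\<lambda>(k, l). nat l)") auto

declare kfib.simps [simp del]

text \<open>
  The family \<open>(x i)\<^sub>i\<^sub>\<in>\<^sub>I\<close>, counted with multiplicity, can be the side lengths of a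
  nondegenerate polygon with \<open>card I\<close> sides: a largest member is strictly less than the sum of
  the others. If the maximum is attained several times, the choice of \<open>m\<close> is immaterial.
\<close>

definition can_form_polygon :: "('i \<Rightarrow> real) \<Rightarrow> 'i set \<Rightarrow> bool" where
  "can_form_polygon x I \<longleftrightarrow>
     (\<exists>m\<in>I. (\<forall>i\<in>I. x i \<le> x m) \<and> x m < (\<Sum>i\<in>I - {m}. x i))"

end

theory Submission
  imports Defs "HOL-Combinatorics.Permutations"
begin

text \<open>
  Almost surely the \<open>U\<^sub>i\<close> are distinct, so exactly one permutation sorts them decreasingly, and each
  of the \<open>n!\<close> orders contributes equally. For \<open>x\<^sub>1 \<ge> \<dots> \<ge> x\<^sub>n \<ge> 0\<close> it suffices to test runs of
  consecutive values: no polygon exists iff \<open>x\<^sub>j \<ge> x\<^sub>j\<^sub>+\<^sub>1 + \<dots> + x\<^sub>j\<^sub>+\<^sub>k\<close> for all \<open>j \<le> n - k\<close>.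
  Together with the ordering of the last \<open>k\<close> values these are triangular constraints
  \<open>x\<^sub>j \<ge> \<Sum>\<^sub>l\<^sub>>\<^sub>j a\<^sub>j\<^sub>l x\<^sub>l\<close> (\<open>a = coeffs k n\<close>). In terms of the slacks
  \<open>y\<^sub>j = x\<^sub>j - \<Sum>\<^sub>l\<^sub>>\<^sub>j a\<^sub>j\<^sub>l x\<^sub>l \<ge> 0\<close> the remaining constraint \<open>x\<^sub>1 \<le> 1\<close> reads \<open>\<Sum>\<^sub>j c\<^sub>j y\<^sub>j \<le> 1\<close>, where
  \<open>c\<^sub>j = [j = 1] + \<Sum>\<^sub>l\<^sub><\<^sub>j c\<^sub>l a\<^sub>l\<^sub>j\<close>, so the region is a simplex of volume \<open>1 / (n! c\<^sub>1 \<dots> c\<^sub>n)\<close>. Solving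
  this recurrence (\<open>c = weight k n\<close>), \<open>c\<^sub>j\<close> is \<open>F\<^sub>k\<^sup>j\<close> for \<open>j \<le> n - k + 2\<close>, and the remaining \<open>k - 2\<close>
  weights are the corrected denominators of the second product, in reverse order.
\<close>

subsection \<open>Volume of a triangular cone below the unit height\<close>

abbreviation unif :: "real measure" where
  "unif \<equiv> uniform_measure lborel {0..1}"

text \<open>
  Integrating out \<open>x\<^sub>1, \<dots>, x\<^sub>m\<close> turns the indicator of \<open>x\<^sub>1 \<le> 1\<close> into a multiple of
  \<open>tail m\<close> of a linear form in the other variables, which avoids an \<open>n\<close>-dimensional change of variables.
\<close>

definition tail :: "nat \<Rightarrow> real \<Rightarrow> real" where
  "tail m s = (if s \<le> 1 then (1 - s) ^ m / fact m else 0)"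

lemma tail_nonneg: "0 \<le> tail m s"
  by (simp add: tail_def)

lemma tail_measurable [measurable]: "tail m \<in> borel_measurable borel"
  unfolding tail_def by measurable

lemma prob_space_unif: "prob_space unif"
  by (rule prob_space_uniform_measure) auto

lemma nn_integral_unif:
  assumes [measurable]: "f \<in> borel_measurable borel"
  shows "(\<integral>\<^sup>+ y. f y \<partial>unif) = (\<integral>\<^sup>+ y. f y * indicator {0..1} y \<partial>lborel)"
  by (subst nn_integral_uniform_measure) (auto simp: divide_ennreal_def)

text \<open>The linear form reaches 1 at \<open>R = (1 - b) / c\<close>, and
  \<open>1 \<le> c\<close>, \<open>0 \<le> b\<close> force \<open>R \<le> 1\<close>. Together with
  \<open>0 \<le> L\<close> this puts the interval from \<open>L\<close> to \<open>R\<close> inside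
  [0,1], so the support of \<open>unif\<close> cuts nothing off. The antiderivative vanishes at
  \<open>R\<close>, which leaves only the boundary term at \<open>L\<close>.\<close>

lemma nn_integral_tail:
  fixes b c L :: real
  assumes "1 \<le> c" "0 \<le> b" "0 \<le> L"
  shows "(\<integral>\<^sup>+ y. (if L \<le> y then ennreal (tail m (c * y + b)) else 0) \<partial>unif) =
    ennreal (tail (Suc m) (c * L + b) / c)"
proof -
  define R where "R = (1 - b) / c"
  have R: "c * y + b \<le> 1 \<longleftrightarrow> y \<le> R" for y
    using assms by (auto simp: R_def field_simps)
  have R1: "R \<le> 1"
    using assms by (simp add: R_def)
  have "(\<integral>\<^sup>+ y. (if L \<le> y then ennreal (tail m (c * y + b)) else 0) \<partial>unif) =
     (\<integral>\<^sup>+ y. (if L \<le> y then ennreal (tail m (c * y + b)) else 0) * indicator {0..1} y \<partial>lborel)"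
    by (rule nn_integral_unif) measurable
  also have "\<dots> = (\<integral>\<^sup>+ y. ennreal ((1 - (c * y + b)) ^ m / fact m) * indicator {L..R} y \<partial>lborel)"
    using assms R R1 by (intro nn_integral_cong) (auto simp: tail_def indicator_def)
  also have "\<dots> = ennreal (tail (Suc m) (c * L + b) / c)"
  proof (cases "L \<le> R")
    case True
    have "(\<integral>\<^sup>+ y. ennreal ((1 - (c * y + b)) ^ m / fact m) * indicator {L..R} y \<partial>lborel) =
      ennreal (- ((1 - (c * R + b)) ^ Suc m / (c * fact (Suc m))) -
        - ((1 - (c * L + b)) ^ Suc m / (c * fact (Suc m))))"
    proof (rule nn_integral_FTC_Icc)
      show "(\<lambda>y. (1 - (c * y + b)) ^ m / fact m) \<in> borel_measurable borel" by measurable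
      fix y assume y: "y \<in> {L..R}"
      \<comment> \<open>\<open>K\<close> gives the integrand the unsimplified shape in which
        differentiating the power produces it.\<close>
      have K: "real (Suc m) * (c * P) / (c * fact (Suc m)) = P / fact m" for P
        using assms by (simp add: divide_simps del: of_nat_Suc)
      show "((\<lambda>y. - ((1 - (c * y + b)) ^ Suc m / (c * fact (Suc m)))) has_real_derivative
          (1 - (c * y + b)) ^ m / fact m) (at y)"
        unfolding K[symmetric]
        by (auto intro!: derivative_eq_intros simp del: of_nat_Suc fact_Suc power_Suc)
      show "0 \<le> (1 - (c * y + b)) ^ m / fact m"
        using R[of y] y by simp
    qed (use True in auto)
    moreover have "1 - (c * R + b) = 0"
      using assms by (simp add: R_def)
    ultimately show ?thesis
      using True R[of L] by (simp add: tail_def mult.commute)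
  next
    case False
    then show ?thesis using R[of L] by (simp add: tail_def)
  qed
  finally show ?thesis .
qed

text \<open>Only the coordinates after \<open>i\<close> occur, that is, those left once the first
  \<open>i\<close> have been integrated out. Row \<open>n\<close> has an empty sum and so demands
  \<open>0 \<le> x n\<close>.\<close>

definition cone :: "(nat \<Rightarrow> nat \<Rightarrow> real) \<Rightarrow> nat \<Rightarrow> nat \<Rightarrow> (nat \<Rightarrow> real) \<Rightarrow> bool" where
  "cone a i n x \<longleftrightarrow> (\<forall>j\<in>{Suc i..n}. (\<Sum>l\<in>{Suc j..n}. a j l * x l) \<le> x j)"

lemma cone_Suc:
  assumes "i < n"
  shows "cone a i n x \<longleftrightarrow>
    (\<Sum>l\<in>{Suc (Suc i)..n}. a (Suc i) l * x l) \<le> x (Suc i) \<and> cone a (Suc i) n x"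
proof -
  have "{Suc i..n} = insert (Suc i) {Suc (Suc i)..n}"
    using assms by auto
  then show ?thesis by (simp add: cone_def)
qed

text \<open>Downward from \<open>n\<close>: each entry dominates a nonnegative combination of later,
  already nonnegative entries.\<close>

lemma cone_nonneg:
  assumes "cone a i n x" "\<And>j l. 0 \<le> a j l" "i < j" "j \<le> n"
  shows "0 \<le> x j"
  using assms(3,4)
proof (induction "n - j" arbitrary: j rule: less_induct)
  case less
  have "0 \<le> (\<Sum>l\<in>{Suc j..n}. a j l * x l)"
    using less assms(2) by (intro sum_nonneg mult_nonneg_nonneg) auto
  also have "\<dots> \<le> x j"
    using assms(1) less.prems by (auto simp: cone_def)
  finally show ?case .
qed

lemma borel_measurable_component_unif:
  "j \<in> I \<Longrightarrow> (\<lambda>x. x j) \<in> borel_measurable (PiM I (\<lambda>_. unif))"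
  using measurable_component_singleton[of j I "\<lambda>_. unif"]
  by (simp add: measurable_cong_sets[OF refl, of unif borel])

lemma cone_measurable:
  assumes "{Suc i..n} \<subseteq> I"
  shows "Measurable.pred (PiM I (\<lambda>_. unif)) (cone a i n)"
  unfolding cone_def using assms
  by (intro pred_intros_finite borel_measurable_le[folded pred_def] borel_measurable_sum borel_measurable_times
      borel_measurable_const borel_measurable_component_unif) auto

text \<open>The linear form is \<open>x 1\<close> expressed through the slacks of rows 1 to
  \<open>i\<close> and the remaining coordinates, with the slack part dropped. At
  \<open>i = n\<close> nothing is left to integrate and \<open>tail n 0\<close> is
  \<open>1 / fact n\<close>. Going down, the recurrence for \<open>c\<close> identifies the
  coefficient of \<open>x (Suc i)\<close> as \<open>c (Suc i)\<close>, so integrating this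
  coordinate contributes a factor \<open>1 / c (Suc i)\<close>.\<close>

lemma nn_integral_cone:
  fixes a :: "nat \<Rightarrow> nat \<Rightarrow> real" and c :: "nat \<Rightarrow> real"
  assumes a: "\<And>j l. 0 \<le> a j l"
    and c1: "\<And>j. j \<in> {1..n} \<Longrightarrow> 1 \<le> c j"
    and c: "\<And>j. j \<in> {1..n} \<Longrightarrow> c j = of_bool (j = 1) + (\<Sum>l\<in>{1..<j}. c l * a l j)"
    and "i \<le> n"
  shows "(\<integral>\<^sup>+ x. (if cone a i n x then
        ennreal (tail i (\<Sum>j\<in>{Suc i..n}. (of_bool (j = 1) + (\<Sum>l\<in>{1..i}. c l * a l j)) * x j))
        else 0) \<partial>PiM {Suc i..n} (\<lambda>_. unif)) =
     ennreal (1 / (fact n * (\<Prod>j\<in>{Suc i..n}. c j)))"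
  using \<open>i \<le> n\<close>
proof (induction i rule: inc_induct)
  case base
  show ?case
    by (simp add: PiM_empty cone_def tail_def nn_integral_count_space_finite)
next
  case (step i)
  interpret product_sigma_finite "\<lambda>_::nat. unif"
    by (simp add: product_sigma_finite_def prob_space_imp_sigma_finite prob_space_unif)
  let ?d = "\<lambda>i j. of_bool (j = 1) + (\<Sum>l\<in>{1..i}. c l * a l j)"
  let ?I = "{Suc (Suc i)..n}"
  have ins: "{Suc i..n} = insert (Suc i) ?I"
    using step by auto
  have ci: "?d i (Suc i) = c (Suc i)"
    using c[of "Suc i"] step by (simp add: atLeastLessThanSuc_atLeastAtMost)
  have c1i: "1 \<le> c (Suc i)"
    using c1 step by simp
  define f where "f x = (if cone a i n x then
      ennreal (tail i (\<Sum>j\<in>{Suc i..n}. ?d i j * x j)) else 0)" for x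
  have f: "f \<in> borel_measurable (PiM {Suc i..n} (\<lambda>_. unif))"
    unfolding f_def
    by (intro measurable_If measurable_compose[OF _ measurable_ennreal]
        measurable_compose[OF _ tail_measurable]
        cone_measurable[unfolded pred_def] borel_measurable_sum borel_measurable_times
      borel_measurable_const borel_measurable_component_unif) auto
  \<comment> \<open>The variable \<open>y\<close> occurs only in its own constraint
    \<open>L \<le> y\<close> and, with coefficient \<open>c (Suc i)\<close>, in the linear form;
    hence \<open>nn_integral_tail\<close> applies.\<close>
  have inner: "(\<integral>\<^sup>+ y. f (x(Suc i := y)) \<partial>unif) =
     ennreal (1 / c (Suc i)) * (if cone a (Suc i) n x then
        ennreal (tail (Suc i) (\<Sum>j\<in>?I. ?d (Suc i) j * x j)) else 0)" for x
  proof (cases "cone a (Suc i) n x")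
    case True
    define L where "L = (\<Sum>l\<in>?I. a (Suc i) l * x l)"
    define b where "b = (\<Sum>j\<in>?I. ?d i j * x j)"
    have x0: "0 \<le> x j" if "j \<in> ?I" for j
      using cone_nonneg[OF True a, of j] that by auto
    have c0: "0 \<le> c j" if "j \<in> {1..n}" for j
      using c1[OF that] by simp
    have L0: "0 \<le> L"
      unfolding L_def using a x0 by (intro sum_nonneg mult_nonneg_nonneg) auto
    have b0: "0 \<le> b"
      unfolding b_def using a x0 c0 step
      by (intro sum_nonneg mult_nonneg_nonneg add_nonneg_nonneg) auto
    have "f (x(Suc i := y)) = (if L \<le> y then ennreal (tail i (c (Suc i) * y + b)) else 0)" for y
    proof -
      have "cone a (Suc i) n (x(Suc i := y)) = cone a (Suc i) n x"
        by (simp add: cone_def)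
      then have "cone a i n (x(Suc i := y)) \<longleftrightarrow> L \<le> y"
        using cone_Suc[of i n a "x(Suc i := y)"] step True by (simp add: L_def)
      moreover have "(\<Sum>j\<in>{Suc i..n}. ?d i j * (x(Suc i := y)) j) = c (Suc i) * y + b"
        unfolding ins b_def using ci by simp
      ultimately show ?thesis by (simp add: f_def)
    qed
    then have "(\<integral>\<^sup>+ y. f (x(Suc i := y)) \<partial>unif) = ennreal (tail (Suc i) (c (Suc i) * L + b) / c (Suc i))"
      using nn_integral_tail[OF c1i b0 L0, of i] by simp
    \<comment> \<open>Replacing \<open>y\<close> by its lower bound adds
      \<open>c (Suc i) * a (Suc i) j\<close> to the coefficient of \<open>x j\<close>, which is the
      next summand of \<open>?d\<close>.\<close>
    also have "c (Suc i) * L + b = (\<Sum>j\<in>?I. ?d (Suc i) j * x j)"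
      by (simp add: L_def b_def sum_distrib_left sum.distrib[symmetric] algebra_simps)
    finally show ?thesis
      using True c1i by (simp add: ennreal_mult'[symmetric] tail_nonneg del: fun_upd_apply)
  next
    case False
    have "cone a (Suc i) n (x(Suc i := y)) = cone a (Suc i) n x" for y
      by (simp add: cone_def)
    then have "f (x(Suc i := y)) = 0" for y
      using cone_Suc[of i n a "x(Suc i := y)"] step False by (simp add: f_def)
    then show ?thesis using False by simp
  qed
  have "(\<integral>\<^sup>+ x. f x \<partial>PiM {Suc i..n} (\<lambda>_. unif)) =
     (\<integral>\<^sup>+ x. (\<integral>\<^sup>+ y. f (x(Suc i := y)) \<partial>unif) \<partial>PiM ?I (\<lambda>_. unif))"
    unfolding ins by (rule product_nn_integral_insert) (use f ins in auto)
  also have "\<dots> = ennreal (1 / c (Suc i)) * ennreal (1 / (fact n * (\<Prod>j\<in>?I. c j)))"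
    unfolding inner step.IH[symmetric]
    by (intro nn_integral_cmult measurable_If measurable_compose[OF _ measurable_ennreal]
        measurable_compose[OF _ tail_measurable]
        cone_measurable[unfolded pred_def] borel_measurable_sum borel_measurable_times
      borel_measurable_const borel_measurable_component_unif) auto
  also have "\<dots> = ennreal (1 / (fact n * (\<Prod>j\<in>{Suc i..n}. c j)))"
    unfolding ins using c1i by (simp add: ennreal_mult'[symmetric] mult.left_commute)
  finally show ?case unfolding f_def .
qed

text \<open>This is \<open>nn_integral_cone\<close> at \<open>i = 0\<close>: there the linear form
  is just \<open>x 1\<close>, and \<open>tail 0\<close> is the indicator of values at most
  1.\<close>

lemma emeasure_cone:
  fixes a :: "nat \<Rightarrow> nat \<Rightarrow> real" and c :: "nat \<Rightarrow> real"
  assumes a: "\<And>j l. 0 \<le> a j l"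
    and c1: "\<And>j. j \<in> {1..n} \<Longrightarrow> 1 \<le> c j"
    and c: "\<And>j. j \<in> {1..n} \<Longrightarrow> c j = of_bool (j = 1) + (\<Sum>l\<in>{1..<j}. c l * a l j)"
    and "1 \<le> n"
  shows "emeasure (PiM {1..n} (\<lambda>_. unif))
      {x \<in> space (PiM {1..n} (\<lambda>_. unif)). cone a 0 n x \<and> x 1 \<le> 1} =
    ennreal (1 / (fact n * (\<Prod>j\<in>{1..n}. c j)))"
proof -
  let ?P = "PiM {1..n} (\<lambda>_. unif)"
  have m: "{x \<in> space ?P. cone a 0 n x \<and> x 1 \<le> 1} \<in> sets ?P"
    using \<open>1 \<le> n\<close>
    by (intro sets.sets_Collect_conj cone_measurable[unfolded pred_def] borel_measurable_le
        borel_measurable_const borel_measurable_component_unif) auto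
  have "(\<Sum>j\<in>{Suc 0..n}. of_bool (j = 1) * x j) = x 1" for x :: "nat \<Rightarrow> real"
  proof -
    have "{Suc 0..n} = insert 1 {2..n}" using \<open>1 \<le> n\<close> by auto
    then show ?thesis by simp
  qed
  then have "(\<integral>\<^sup>+ x. indicator {x \<in> space ?P. cone a 0 n x \<and> x 1 \<le> 1} x \<partial>?P) =
     ennreal (1 / (fact n * (\<Prod>j\<in>{1..n}. c j)))"
    using nn_integral_cone[OF a c1 c, of n 0]
    by (auto simp: tail_def indicator_def cong: if_cong intro!: nn_integral_cong elim!: trans[rotated])
  then show ?thesis using m by simp
qed

subsection \<open>The slack weights\<close>

definition fib :: "nat \<Rightarrow> nat \<Rightarrow> real" where
  "fib k l = real (kfib k (int l))"

lemma fib_0 [simp]: "fib k 0 = 0"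
  by (simp add: fib_def kfib.simps)

lemma fib_1 [simp]: "fib k (Suc 0) = 1"
  by (simp add: fib_def kfib.simps)

text \<open>Truncation of \<open>l - k\<close> at 0 is harmless, because all terms of index at most
  0 vanish.\<close>

lemma fib_rec:
  assumes "2 \<le> l"
  shows "fib k l = (\<Sum>j\<in>{l - k..<l}. fib k j)"
proof -
  have neg: "kfib k z = 0" if "z \<le> 0" for z
    using that by (simp add: kfib.simps)
  have "fib k l = (\<Sum>j\<in>{1..k}. real (kfib k (int l - int j)))"
    using assms by (simp add: fib_def kfib.simps[of k "int l"])
  also have "\<dots> = (\<Sum>j\<in>{1..min k l}. real (kfib k (int l - int j)))"
    by (rule sum.mono_neutral_right) (auto simp: neg)
  also have "\<dots> = (\<Sum>j\<in>{l - k..<l}. fib k j)"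
    by (rule sum.reindex_bij_witness[of _ "\<lambda>j. l - j" "\<lambda>j. l - j"])
      (auto simp: fib_def of_nat_diff)
  finally show ?thesis .
qed

definition coeffs :: "nat \<Rightarrow> nat \<Rightarrow> nat \<Rightarrow> nat \<Rightarrow> real" where
  "coeffs k n j l = of_bool (j < l \<and> l \<le> n \<and> (if j \<le> n - k then l \<le> j + k else l = Suc j))"

text \<open>The subtracted term is an iterated partial sum of the Fibonacci terms after index
  \<open>n - k\<close>. It accumulates what the full Fibonacci recurrence would add but the pure
  ordering rows do not. For \<open>i \<le> n - k + 2\<close> its range is empty.\<close>

definition weight :: "nat \<Rightarrow> nat \<Rightarrow> nat \<Rightarrow> real" where
  "weight k n i = fib k i -
     (\<Sum>j\<in>{1..i - (n - k) - 2}. (real i - real (n - k) - 1 - real j) * fib k (n - k + j))"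

lemma weight_eq_fib: "i \<le> n - k + 2 \<Longrightarrow> weight k n i = fib k i"
  by (simp add: weight_def)

text \<open>The window of \<open>k\<close> terms that make up \<open>fib k (Suc i)\<close> splits
  into \<open>fib k i\<close>, the terms strictly between \<open>n - k\<close> and \<open>i\<close>,
  and the terms up to \<open>n - k\<close>. Passing to \<open>Suc i\<close> raises each factor of
  the correction by one, which cancels exactly the middle block.\<close>

lemma weight_Suc:
  assumes "k \<le> n" "2 \<le> k" "n - k + 1 \<le> i" "i < n"
  shows "weight k n (Suc i) = weight k n i + (\<Sum>l\<in>{Suc i - k..n - k}. fib k l)"
proof -
  define m where "m = n - k"
  define p where "p = i - m - 1"
  have i: "i = m + 1 + p" using assms by (simp add: p_def m_def)
  have "(\<Sum>j\<in>{1..p}. (real (Suc i) - real m - 1 - real j) * fib k (m + j)) =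
      (\<Sum>j\<in>{1..p}. (real i - real m - 1 - real j) * fib k (m + j)) + (\<Sum>j\<in>{1..p}. fib k (m + j))"
    by (simp add: sum.distrib[symmetric] algebra_simps)
  \<comment> \<open>The factor at \<open>j = p\<close> is zero, so the ranges for \<open>i\<close>
    and \<open>Suc i\<close> can be aligned.\<close>
  moreover have "(\<Sum>j\<in>{1..p}. (real i - real m - 1 - real j) * fib k (m + j)) =
      (\<Sum>j\<in>{1..p - 1}. (real i - real m - 1 - real j) * fib k (m + j))"
    by (rule sum.mono_neutral_right) (auto simp: i not_le)
  moreover have "(\<Sum>j\<in>{1..p}. fib k (m + j)) = (\<Sum>l\<in>{Suc m..<i}. fib k l)"
    by (rule sum.reindex_bij_witness[of _ "\<lambda>l. l - m" "\<lambda>j. m + j"]) (auto simp: i)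
  moreover have "fib k (Suc i) = fib k i + (\<Sum>l\<in>{Suc m..<i}. fib k l) + (\<Sum>l\<in>{Suc i - k..m}. fib k l)"
  proof -
    have "{Suc i - k..<Suc i} = insert i ({Suc m..<i} \<union> {Suc i - k..m})"
      using assms i by (auto simp: m_def)
    moreover have "i \<notin> {Suc m..<i} \<union> {Suc i - k..m}" "{Suc m..<i} \<inter> {Suc i - k..m} = {}"
      using i by auto
    ultimately show ?thesis
      using fib_rec[of "Suc i" k] i by (simp add: sum.union_disjoint)
  qed
  ultimately show ?thesis
    unfolding weight_def m_def[symmetric] using i by simp
qed

text \<open>Read \<open>coeffs\<close> by columns. Up to column \<open>n - k + 1\<close> the ones
  sit in the preceding \<open>k\<close> rows, which gives the Fibonacci recurrence. In a later
  column \<open>j\<close> they sit in row \<open>j - 1\<close>, an ordering row, and in rows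
  \<open>j - k\<close> to \<open>n - k\<close>, which gives \<open>weight_Suc\<close>.\<close>

lemma weight_rec:
  assumes "2 \<le> k" "k \<le> n" "j \<in> {1..n}"
  shows "weight k n j = of_bool (j = 1) + (\<Sum>l\<in>{1..<j}. weight k n l * coeffs k n l j)"
proof -
  define m where "m = n - k"
  consider "j = 1" | "2 \<le> j" "j \<le> m + 1" | "m + 1 < j" "2 \<le> j" using assms by force
  then show ?thesis
  proof cases
    case 1
    then show ?thesis by (simp add: weight_def)
  next
    case 2
    have "weight k n j = (\<Sum>l\<in>{j - k..<j}. fib k l)"
      using 2 by (simp add: weight_eq_fib m_def fib_rec)
    also have "\<dots> = (\<Sum>l\<in>{1..<j} \<inter> {j - k..<j}. fib k l)"
      by (rule sum.mono_neutral_right) (auto simp: not_le)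
    also have "\<dots> = (\<Sum>l\<in>{1..<j}. if l \<in> {j - k..<j} then fib k l else 0)"
      by (rule sum.inter_restrict) simp
    also have "\<dots> = (\<Sum>l\<in>{1..<j}. weight k n l * coeffs k n l j)"
      using 2 assms by (intro sum.cong) (auto simp: weight_eq_fib coeffs_def m_def)
    finally show ?thesis using 2 by simp
  next
    case 3
    then obtain i where i: "j = Suc i" "m + 1 \<le> i" by (cases j) auto
    have "(\<Sum>l\<in>{1..<j}. weight k n l * coeffs k n l j) =
       weight k n i * coeffs k n i j + (\<Sum>l\<in>{1..<i}. weight k n l * coeffs k n l j)"
      using i by (simp add: atLeastLessThanSuc)
    also have "weight k n i * coeffs k n i j = weight k n i"
      using i assms by (simp add: coeffs_def m_def)
    also have "(\<Sum>l\<in>{1..<i}. weight k n l * coeffs k n l j) =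
       (\<Sum>l\<in>{1..<i}. if l \<in> {j - k..m} then fib k l else 0)"
      using i assms by (intro sum.cong) (auto simp: weight_eq_fib coeffs_def m_def)
    also have "\<dots> = (\<Sum>l\<in>{1..<i} \<inter> {j - k..m}. fib k l)"
      by (rule sum.inter_restrict[symmetric]) simp
    \<comment> \<open>If \<open>j \<le> k\<close>, the truncated lower end is 0, an index outside
      \<open>{1..<i}\<close> whose term is zero.\<close>
    also have "\<dots> = (\<Sum>l\<in>{j - k..m}. fib k l)"
    proof (rule sum.mono_neutral_left)
      show "\<forall>l\<in>{j - k..m} - {1..<i} \<inter> {j - k..m}. fib k l = 0"
      proof
        fix l assume "l \<in> {j - k..m} - {1..<i} \<inter> {j - k..m}"
        then have "l = 0" using i by auto
        then show "fib k l = 0" by simp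
      qed
    qed auto
    finally show ?thesis
      using weight_Suc[of k n i] assms i by (simp add: m_def)
  qed
qed

text \<open>Subtraction hides the sign in the closed form, but the recurrence has nonnegative terms,
  among them the full weight of \<open>j - 1\<close>. The bound is what \<open>emeasure_cone\<close>
  asks of its weights.\<close>

lemma weight_ge_1:
  assumes "2 \<le> k" "k \<le> n" "j \<in> {1..n}"
  shows "1 \<le> weight k n j"
  using assms(3)
proof (induction j rule: less_induct)
  case (less j)
  note rec = weight_rec[OF assms(1,2) less.prems]
  have nn: "0 \<le> weight k n l * coeffs k n l j" if "l \<in> {1..<j}" for l
    using less.IH[of l] less.prems that by (simp add: coeffs_def)
  show ?case
  proof (cases "j = 1")
    case True
    then show ?thesis using rec by simp
  next
    case False
    then have "j - 1 \<in> {1..<j}" using less.prems by auto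
    then have "weight k n (j - 1) * coeffs k n (j - 1) j \<le>
        (\<Sum>l\<in>{1..<j}. weight k n l * coeffs k n l j)"
      using nn by (intro member_le_sum) auto
    moreover have "coeffs k n (j - 1) j = 1"
      using less.prems False assms by (auto simp: coeffs_def)
    moreover have "1 \<le> weight k n (j - 1)"
      using less False by auto
    ultimately show ?thesis using rec False by simp
  qed
qed

lemma prod_weight:
  assumes "2 \<le> k" "k \<le> n"
  shows "1 / (\<Prod>j\<in>{1..n}. weight k n j) =
         (\<Prod>l\<in>{1..n - k + 2}. 1 / real (kfib k (int l))) *
           (\<Prod>i\<in>{1..k - 2}.
              1 / (real (kfib k (int n - int i + 1)) -
                   (\<Sum>j\<in>{1..k - i - 1}.
                      (real k - real i - real j) * real (kfib k (int n - int k + int j)))))"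
proof -
  have "{1..n} = {1..n - k + 2} \<union> {n - k + 3..n}"
    using assms by auto
  then have "(\<Prod>j\<in>{1..n}. 1 / weight k n j) =
      (\<Prod>j\<in>{1..n - k + 2}. 1 / weight k n j) * (\<Prod>j\<in>{n - k + 3..n}. 1 / weight k n j)"
    by (simp add: prod.union_disjoint)
  also have "(\<Prod>j\<in>{1..n - k + 2}. 1 / weight k n j) = (\<Prod>l\<in>{1..n - k + 2}. 1 / real (kfib k (int l)))"
    by (intro prod.cong) (simp_all add: weight_eq_fib fib_def)
  \<comment> \<open>The reflection taking \<open>i\<close> to \<open>n - i + 1\<close> is its own
    inverse and exchanges the two index ranges.\<close>
  also have "(\<Prod>j\<in>{n - k + 3..n}. 1 / weight k n j) = (\<Prod>i\<in>{1..k - 2}. 1 / weight k n (n - i + 1))"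
    using assms by (intro prod.reindex_bij_witness[of _ "\<lambda>i. n - i + 1" "\<lambda>i. n - i + 1"]) auto
  also have "\<dots> = (\<Prod>i\<in>{1..k - 2}.
              1 / (real (kfib k (int n - int i + 1)) -
                   (\<Sum>j\<in>{1..k - i - 1}.
                      (real k - real i - real j) * real (kfib k (int n - int k + int j)))))"
  proof (rule prod.cong)
    fix i assume i: "i \<in> {1..k - 2}"
    have "int (n - i + 1) = int n - int i + 1" "n - i + 1 - (n - k) - 2 = k - i - 1"
      using i assms by auto
    moreover have "real (n - i + 1) - real (n - k) - 1 - real j = real k - real i - real j" for j
      using i assms by (auto simp: of_nat_diff)
    moreover have "int (n - k + j) = int n - int k + int j" for j
      using assms by (simp add: of_nat_diff)
    ultimately show "1 / weight k n (n - i + 1) = 1 / (real (kfib k (int n - int i + 1)) -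
                   (\<Sum>j\<in>{1..k - i - 1}.
                      (real k - real i - real j) * real (kfib k (int n - int k + int j))))"
      by (simp only: weight_def fib_def)
  qed simp
  finally show ?thesis by (simp add: prod_dividef)
qed

subsection \<open>Reduction to sorted sequences\<close>

text \<open>Remove the largest index \<open>m\<close> of a set of size \<open>Suc k\<close>. Since
  the set fits between \<open>Suc i\<close> and \<open>m\<close>, one has
  \<open>i + Suc k \<le> m\<close>, so the removed value is at most the last value of the initial
  segment.\<close>

lemma sum_antimono_le:
  fixes f :: "nat \<Rightarrow> real"
  assumes "antimono_on {1..n} f" "S \<subseteq> {Suc i..n}" "card S = k"
  shows "i + k \<le> n \<or> k = 0" "sum f S \<le> sum f {Suc i..i + k}"
proof -
  have "(i + k \<le> n \<or> k = 0) \<and> sum f S \<le> sum f {Suc i..i + k}"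
    using assms(2,3)
  proof (induction k arbitrary: S)
    case 0
    then have "S = {}" by (metis card_0_eq finite_atLeastAtMost finite_subset)
    then show ?case by simp
  next
    case (Suc k)
    have fin: "finite S" using Suc.prems(1) by (rule finite_subset) simp
    define m where "m = Max S"
    have "S \<noteq> {}" using Suc.prems by auto
    then have m: "m \<in> S" using fin by (simp add: m_def)
    have sub: "S \<subseteq> {Suc i..m}" using Suc.prems fin by (auto simp: m_def)
    have "Suc k \<le> m - i"
      using card_mono[OF _ sub] Suc.prems by simp
    then have ge: "i + Suc k \<le> m" by simp
    have "sum f (S - {m}) \<le> sum f {Suc i..i + k}"
      using Suc.IH[of "S - {m}"] Suc.prems m fin by (auto simp: card_Diff_singleton)
    moreover have "f m \<le> f (i + Suc k)"
      using assms(1) ge m Suc.prems by (intro monotone_onD[OF assms(1)]) auto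
    ultimately show ?case
      using sum.remove[OF fin m, of f] ge m Suc.prems by auto
  qed
  then show "i + k \<le> n \<or> k = 0" "sum f S \<le> sum f {Suc i..i + k}" by blast+
qed

lemma cone_iff:
  assumes "1 \<le> k" "k \<le> n"
  shows "cone (coeffs k n) 0 n x \<longleftrightarrow>
    (\<forall>j\<in>{1..n - k}. sum x {Suc j..j + k} \<le> x j) \<and>
    (\<forall>j\<in>{n - k + 1..<n}. x (Suc j) \<le> x j) \<and> 0 \<le> x n"
proof -
  have 1: "(\<Sum>l\<in>{Suc j..n}. coeffs k n j l * x l) = sum x {Suc j..j + k}" if "j \<in> {1..n - k}" for j
  proof -
    have "(\<Sum>l\<in>{Suc j..n}. coeffs k n j l * x l) = (\<Sum>l\<in>{Suc j..j + k}. coeffs k n j l * x l)"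
      using that assms by (intro sum.mono_neutral_right) (auto simp: coeffs_def)
    also have "\<dots> = sum x {Suc j..j + k}"
      using that assms by (intro sum.cong) (auto simp: coeffs_def)
    finally show ?thesis .
  qed
  have 2: "(\<Sum>l\<in>{Suc j..n}. coeffs k n j l * x l) = x (Suc j)" if "j \<in> {n - k + 1..<n}" for j
  proof -
    have "(\<Sum>l\<in>{Suc j..n}. coeffs k n j l * x l) = (\<Sum>l\<in>{Suc j}. coeffs k n j l * x l)"
      using that assms by (intro sum.mono_neutral_right) (auto simp: coeffs_def)
    also have "\<dots> = x (Suc j)"
      using that assms by (auto simp: coeffs_def)
    finally show ?thesis .
  qed
  have "{Suc 0..n} = {1..n - k} \<union> {n - k + 1..<n} \<union> {n}"
    using assms by auto
  then show ?thesis
    unfolding cone_def using 1 2 by (simp add: ball_Un) blast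
qed

text \<open>The first \<open>n - k\<close> rows do not state the ordering, but there
  \<open>x (Suc j)\<close> is one of the nonnegative summands that \<open>x j\<close>
  dominates.\<close>

lemma cone_antimono:
  assumes "1 \<le> k" "k \<le> n" "cone (coeffs k n) 0 n x"
  shows "antimono_on {1..n} x"
proof -
  have nn: "0 \<le> x j" if "j \<in> {1..n}" for j
    using cone_nonneg[OF assms(3)] that by (auto simp: coeffs_def)
  have step: "x (Suc j) \<le> x j" if "j \<in> {1..<n}" for j
  proof (cases "j \<le> n - k")
    case True
    then have "x (Suc j) \<le> sum x {Suc j..j + k}"
      using that assms(1,2) nn by (intro member_le_sum) auto
    also have "\<dots> \<le> x j"
      using assms True that unfolding cone_iff[OF assms(1,2)] by auto
    finally show ?thesis .
  next
    case False
    then show ?thesis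
      using assms that unfolding cone_iff[OF assms(1,2)] by auto
  qed
  have "x j \<le> x i" if "i \<le> j" "1 \<le> i" "j \<le> n" for i j
    using that
  proof (induction j rule: dec_induct)
    case (step j)
    then show ?case using \<open>\<And>j. j \<in> {1..<n} \<Longrightarrow> x (Suc j) \<le> x j\<close>[of j] by auto
  qed simp
  then show ?thesis by (auto simp: monotone_on_def)
qed

lemma can_form_polygon_cong:
  "(\<And>i. i \<in> I \<Longrightarrow> x i = y i) \<Longrightarrow> can_form_polygon x I = can_form_polygon y I"
  by (simp add: can_form_polygon_def)

lemma can_form_polygon_image:
  assumes "inj_on s I"
  shows "can_form_polygon x (s ` I) \<longleftrightarrow> can_form_polygon (x \<circ> s) I"
proof -
  have "sum x (s ` I - {s m}) = sum (x \<circ> s) (I - {m})" if "m \<in> I" for m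
  proof -
    have "s ` I - {s m} = s ` (I - {m})"
      using assms that by (auto simp: inj_on_def)
    moreover have "inj_on s (I - {m})"
      using assms by (rule inj_on_subset) auto
    ultimately show ?thesis by (simp add: sum.reindex)
  qed
  then show ?thesis by (auto simp: can_form_polygon_def)
qed

definition no_polygon :: "nat \<Rightarrow> nat \<Rightarrow> (nat \<Rightarrow> real) \<Rightarrow> bool" where
  "no_polygon k n x \<longleftrightarrow> (\<forall>I. I \<subseteq> {1..n} \<and> card I = k + 1 \<longrightarrow> \<not> can_form_polygon x I)"

text \<open>A permutation maps the index sets of size \<open>k + 1\<close> bijectively onto
  themselves; for the converse, a given set is the image of its preimage under
  \<open>s\<close>.\<close>

lemma no_polygon_permute:
  assumes "s permutes {1..n}"
  shows "no_polygon k n (x \<circ> s) \<longleftrightarrow> no_polygon k n x"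
proof -
  have inj: "inj_on s I" for I
    using assms by (meson inj_on_subset permutes_inj subset_UNIV)
  have "(\<forall>I. I \<subseteq> {1..n} \<and> card I = k + 1 \<longrightarrow> \<not> can_form_polygon x I) \<longleftrightarrow>
    (\<forall>I. I \<subseteq> {1..n} \<and> card I = k + 1 \<longrightarrow> \<not> can_form_polygon x (s ` I))" (is "?L \<longleftrightarrow> ?R")
  proof
    assume ?L
    then show ?R
      using card_image[OF inj] permutes_image[OF assms] by (metis image_mono)
  next
    assume R: ?R
    show ?L
    proof (intro allI impI)
      fix I assume I: "I \<subseteq> {1..n} \<and> card I = k + 1"
      let ?J = "inv s ` I"
      have "?J \<subseteq> {1..n}"
        using I permutes_image[OF permutes_inv[OF assms]] by (metis image_mono)
      moreover have "card ?J = k + 1"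
        using I by (metis card_image inj_on_subset permutes_inj permutes_inv[OF assms] subset_UNIV)
      moreover have "s ` ?J = I"
        by (metis assms image_f_inv_f permutes_surj)
      ultimately show "\<not> can_form_polygon x I"
        using R by metis
    qed
  qed
  then show ?thesis
    by (simp add: no_polygon_def can_form_polygon_image[OF inj])
qed

text \<open>In a decreasing sequence the smallest index \<open>j\<close> of a set carries its
  maximum, and the other \<open>k\<close> values sum to at most the \<open>k\<close> values right
  after \<open>j\<close>. So intervals \<open>{j..j + k}\<close> are the worst case.\<close>

lemma no_polygon_iff_cone:
  assumes "1 \<le> k" "k \<le> n" "antimono_on {1..n} x" "\<And>j. j \<in> {1..n} \<Longrightarrow> 0 \<le> x j"
  shows "no_polygon k n x \<longleftrightarrow> cone (coeffs k n) 0 n x"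
proof -
  have "no_polygon k n x \<longleftrightarrow> (\<forall>j\<in>{1..n - k}. sum x {Suc j..j + k} \<le> x j)" (is "_ \<longleftrightarrow> ?R")
  proof
    assume L: "no_polygon k n x"
    show ?R
    proof
      fix j assume j: "j \<in> {1..n - k}"
      have "\<not> can_form_polygon x {j..j + k}"
        using L j assms unfolding no_polygon_def by (auto dest: spec[of _ "{j..j + k}"])
      moreover have "\<forall>i\<in>{j..j + k}. x i \<le> x j"
        using assms(2,3) j by (auto intro!: monotone_onD[OF assms(3)])
      moreover have "{j..j + k} - {j} = {Suc j..j + k}" by auto
      ultimately show "sum x {Suc j..j + k} \<le> x j"
        unfolding can_form_polygon_def by (force simp: not_less)
    qed
  next
    assume R: ?R
    show "no_polygon k n x"
      unfolding no_polygon_def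
    proof (intro allI impI notI)
      fix I assume I: "I \<subseteq> {1..n} \<and> card I = k + 1"
      assume "can_form_polygon x I"
      then obtain m where m: "m \<in> I" "\<And>i. i \<in> I \<Longrightarrow> x i \<le> x m" "x m < sum x (I - {m})"
        by (auto simp: can_form_polygon_def)
      have fin: "finite I" using I finite_subset by blast
      define j where "j = Min I"
        have j: "j \<in> I" unfolding j_def using m(1) fin by (intro Min_in) auto
      \<comment> \<open>With ties the witness \<open>m\<close> may differ from the smallest index
        \<open>j\<close>; equal values allow exchanging them.\<close>
      have jm: "x m = x j"
      proof (rule antisym)
        have "j \<le> m" using m(1) fin by (simp add: j_def)
        moreover have "m \<in> {1..n}" "j \<in> {1..n}"
          using I m(1) j by blast+
        ultimately show "x m \<le> x j"
          using monotone_onD[OF assms(3), of j m] by simp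
        show "x j \<le> x m" using m(2)[OF j] .
      qed
      have "sum x (I - {m}) = sum x (I - {j})"
        using sum.remove[OF fin m(1), of x] sum.remove[OF fin j, of x] jm by simp
      also have S: "I - {j} \<subseteq> {Suc j..n}"
      proof
        fix i assume i: "i \<in> I - {j}"
        then have "j \<le> i" using fin by (auto simp: j_def)
        then show "i \<in> {Suc j..n}" using i I by auto
      qed
      note ** = sum_antimono_le[OF assms(3) S, of k]
      have "card (I - {j}) = k" using I j fin by simp
      then have "j + k \<le> n" "sum x (I - {j}) \<le> sum x {Suc j..j + k}"
        using ** assms(1) by auto
      moreover have "sum x {Suc j..j + k} \<le> x j"
        using R \<open>j + k \<le> n\<close> j I by auto
      ultimately show False
        using m(3) jm \<open>sum x (I - {m}) = sum x (I - {j})\<close> by linarith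
    qed
  qed
  moreover have "\<forall>j\<in>{n - k + 1..<n}. x (Suc j) \<le> x j"
    using assms(3) by (auto intro!: monotone_onD[OF assms(3)])
  ultimately show ?thesis
    using assms(1,2) assms(4)[of n] by (simp add: cone_iff)
qed

text \<open>The inverse of the decreasing rank \<open>r\<close> sorts. Conversely, if
  \<open>s\<close> sorts, the values at least \<open>x (s i)\<close> are those at
  \<open>s 1, ..., s i\<close>, so \<open>s i\<close> has rank \<open>i\<close> and \<open>s\<close>
  is that inverse.\<close>

lemma ex1_sorting_permutation:
  fixes x :: "nat \<Rightarrow> real"
  assumes "inj_on x {1..n}"
  shows "\<exists>!s. s permutes {1..n} \<and> antimono_on {1..n} (x \<circ> s)"
proof -
  \<comment> \<open>Outside the index range \<open>r\<close> is the identity, as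
    \<open>permutes\<close> demands.\<close>
  define r where "r i = (if i \<in> {1..n} then card {j\<in>{1..n}. x i \<le> x j} else i)" for i
  have mono: "r i < r j" if "i \<in> {1..n}" "j \<in> {1..n}" "x j < x i" for i j
  proof -
    have "{l\<in>{1..n}. x i \<le> x l} \<subset> {l\<in>{1..n}. x j \<le> x l}"
    proof
      show "{l\<in>{1..n}. x i \<le> x l} \<subseteq> {l\<in>{1..n}. x j \<le> x l}"
        using that by auto
      have "j \<in> {l\<in>{1..n}. x j \<le> x l}" "j \<notin> {l\<in>{1..n}. x i \<le> x l}"
        using that by auto
      then show "{l\<in>{1..n}. x i \<le> x l} \<noteq> {l\<in>{1..n}. x j \<le> x l}"
        by blast
    qed
    then have "card {l\<in>{1..n}. x i \<le> x l} < card {l\<in>{1..n}. x j \<le> x l}"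
      by (intro psubset_card_mono) auto
    then show ?thesis
      using that(1,2) by (simp only: r_def if_True)
  qed
  have inj: "inj_on r {1..n}"
  proof (rule inj_onI)
    fix i j assume ij: "i \<in> {1..n}" "j \<in> {1..n}" "r i = r j"
    have "x i = x j"
      using mono[OF ij(1,2)] mono[OF ij(2,1)] ij(3) by (cases "x i" "x j" rule: linorder_cases) auto
    then show "i = j" using inj_onD[OF assms] ij by blast
  qed
  have range: "r i \<in> {1..n}" if "i \<in> {1..n}" for i
  proof -
    have "{j\<in>{1..n}. x i \<le> x j} \<noteq> {}" using that by auto
    then have "0 < card {j\<in>{1..n}. x i \<le> x j}" by (simp add: card_gt_0_iff)
    moreover have "card {j\<in>{1..n}. x i \<le> x j} \<le> card {1..n}"
      by (intro card_mono) auto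
    ultimately show ?thesis using that by (simp add: r_def)
  qed
  have "r ` {1..n} = {1..n}"
    using inj range by (intro endo_inj_surj) auto
  then have r: "r permutes {1..n}"
    using inj by (intro bij_imp_permutes) (auto simp: bij_betw_def r_def)
  have "antimono_on {1..n} (x \<circ> inv r)"
  proof (rule monotone_onI)
    fix i j assume ij: "i \<in> {1..n}" "j \<in> {1..n}" "i \<le> j"
    have "inv r i \<in> {1..n}" "inv r j \<in> {1..n}"
      using ij permutes_in_image[OF permutes_inv[OF r]] by blast+
    moreover have "r (inv r i) = i" "r (inv r j) = j"
      using r by (simp_all add: permutes_inverses)
    ultimately show "(x \<circ> inv r) j \<le> (x \<circ> inv r) i"
      using mono[of "inv r j" "inv r i"] ij by (auto simp: not_less[symmetric])
  qed
  then have "inv r permutes {1..n} \<and> antimono_on {1..n} (x \<circ> inv r)"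
    using permutes_inv[OF r] by blast
  moreover have "s = inv r" if "s permutes {1..n} \<and> antimono_on {1..n} (x \<circ> s)" for s
  proof -
    have s: "s permutes {1..n}" "antimono_on {1..n} (x \<circ> s)"
      using that by blast+
    have "r (s i) = i" for i
    proof (cases "i \<in> {1..n}")
      case True
      have inj': "inj_on (x \<circ> s) {1..n}"
        using assms s(1) permutes_inj_on[OF s(1)] by (intro comp_inj_on) (auto simp: permutes_image)
      have "{j\<in>s ` {1..n}. x (s i) \<le> x j} = s ` {j\<in>{1..n}. x (s i) \<le> x (s j)}"
        by blast
      then have "{j\<in>{1..n}. x (s i) \<le> x j} = s ` {j\<in>{1..n}. x (s i) \<le> x (s j)}"
        by (simp only: permutes_image[OF s(1)])
      also have "{j\<in>{1..n}. x (s i) \<le> x (s j)} = {1..i}"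
      proof -
        have "x (s i) \<le> x (s j) \<longleftrightarrow> j \<le> i" if j: "j \<in> {1..n}" for j
        proof (cases "j \<le> i")
          case le: True
          then show ?thesis using monotone_onD[OF s(2) j True le] by simp
        next
          case False
          then have "x (s j) \<le> x (s i)" using monotone_onD[OF s(2) True j] by simp
          \<comment> \<open>Injectivity makes the sorted sequence strictly decreasing, so no
            position after \<open>i\<close> is counted in the rank.\<close>
          moreover have "x (s i) \<noteq> x (s j)"
            using inj_onD[OF inj' _ True j] False by auto
          ultimately show ?thesis using False by simp
        qed
        then show ?thesis using True by auto
      qed
      also have "card (s ` {1..i}) = i"
        using permutes_inj_on[OF s(1)] by (simp add: card_image)
      moreover have "s i \<in> {1..n}"
        using permutes_in_image[OF s(1)] True by blast
      ultimately show ?thesis by (simp add: r_def)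
    next
      case False
      then show ?thesis using permutes_not_in[OF s(1) False] by (auto simp: r_def)
    qed
    then have "s i = inv r i" for i
      using permutes_inverses(2)[OF r, of "s i"] by simp
    then show ?thesis by blast
  qed
  ultimately show ?thesis
    by (rule ex1I)
qed

subsection \<open>The probability of the event\<close>

abbreviation cube :: "nat \<Rightarrow> (nat \<Rightarrow> real) measure" where
  "cube n \<equiv> PiM {1..n} (\<lambda>_. unif)"

lemma prob_space_cube: "prob_space (cube n)"
  by (intro prob_space_PiM prob_space_unif)

lemma cone_cong:
  "(\<And>j. j \<in> {Suc i..n} \<Longrightarrow> x j = y j) \<Longrightarrow> cone a i n x = cone a i n y"
  unfolding cone_def by (intro ball_cong refl arg_cong2[where f = "(\<le>)"] sum.cong) auto

lemma no_polygon_cong: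
  assumes "\<And>j. j \<in> {1..n} \<Longrightarrow> x j = y j"
  shows "no_polygon k n x = no_polygon k n y"
proof -
  have "can_form_polygon x I = can_form_polygon y I" if "I \<subseteq> {1..n}" for I
    using assms that by (intro can_form_polygon_cong) auto
  then show ?thesis by (auto simp: no_polygon_def)
qed

lemma no_polygon_measurable: "Measurable.pred (cube n) (no_polygon k n)"
proof -
  let ?F = "{I. I \<subseteq> {1..n} \<and> card I = k + 1}"
  have comp: "(\<lambda>x. x i) \<in> borel_measurable (cube n)" if "I \<in> ?F" "i \<in> I" for i I
    using that by (intro borel_measurable_component_unif) auto
  have fin: "finite I" if "I \<in> ?F" for I
    using that finite_subset by blast
  have "Measurable.pred (cube n) (\<lambda>x. \<forall>I\<in>?F. \<not> (\<exists>m\<in>I. (\<forall>i\<in>I. x i \<le> x m) \<and> x m < (\<Sum>i\<in>I - {m}. x i)))"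
    by (intro pred_intros_finite pred_intros_logic borel_measurable_le[folded pred_def]
        borel_measurable_less[folded pred_def] borel_measurable_sum comp fin) auto
  moreover have "no_polygon k n = (\<lambda>x. \<forall>I\<in>?F. \<not> (\<exists>m\<in>I. (\<forall>i\<in>I. x i \<le> x m) \<and> x m < (\<Sum>i\<in>I - {m}. x i)))"
    by (auto simp: no_polygon_def can_form_polygon_def fun_eq_iff)
  ultimately show ?thesis by simp
qed

text \<open>Integrate coordinate \<open>i\<close> first: with the others fixed, the section of the
  diagonal lies in the single point \<open>x j\<close>, a null set.\<close>

lemma AE_cube_neq:
  assumes "i \<in> {1..n}" "j \<in> {1..n}" "i \<noteq> j"
  shows "AE x in cube n. x i \<noteq> x j"
proof -
  interpret product_sigma_finite "\<lambda>_::nat. unif"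
    by (simp add: product_sigma_finite_def prob_space_imp_sigma_finite prob_space_unif)
  let ?S = "{x \<in> space (cube n). x i = x j}"
  have ins: "insert i ({1..n} - {i}) = {1..n}"
    using assms by auto
  have S: "?S \<in> sets (cube n)"
    using assms by (intro borel_measurable_eq borel_measurable_component_unif)
  have "emeasure (cube n) ?S = (\<integral>\<^sup>+ x. indicator ?S x \<partial>PiM (insert i ({1..n} - {i})) (\<lambda>_. unif))"
    using S by (simp only: ins nn_integral_indicator)
  also have "\<dots> = (\<integral>\<^sup>+ x. (\<integral>\<^sup>+ y. indicator ?S (x(i := y)) \<partial>unif) \<partial>PiM ({1..n} - {i}) (\<lambda>_. unif))"
    by (rule product_nn_integral_insert) (use S ins in \<open>auto simp only: intro!: borel_measurable_indicator\<close>)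
  also have "\<dots> \<le> (\<integral>\<^sup>+ x. (\<integral>\<^sup>+ y. indicator {x j} y \<partial>unif) \<partial>PiM ({1..n} - {i}) (\<lambda>_. unif))"
    using assms by (intro nn_integral_mono) (auto simp: indicator_def)
  also have "\<dots> = 0"
    by (simp add: emeasure_uniform_measure emeasure_lborel_countable)
  finally have "emeasure (cube n) ?S = 0" by simp
  then show ?thesis
    by (intro AE_I[OF _ _ S]) auto
qed

text \<open>The space of \<open>unif\<close> is the whole real line, so even the bounds on the
  coordinates hold only almost surely.\<close>

lemma AE_cube:
  "AE x in cube n. inj_on x {1..n} \<and> (\<forall>i\<in>{1..n}. x i \<in> {0..1})"
proof (rule AE_conjI)
  have "AE x in cube n. \<forall>i\<in>{1..n}. \<forall>j\<in>{1..n}. i \<noteq> j \<longrightarrow> x i \<noteq> x j"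
  proof (intro AE_finite_allI)
    fix i j assume "i \<in> {1..n}" "j \<in> {1..n}"
    then show "AE x in cube n. i \<noteq> j \<longrightarrow> x i \<noteq> x j"
      by (cases "i = j") (use AE_cube_neq in auto)
  qed auto
  then show "AE x in cube n. inj_on x {1..n}"
    by (rule AE_mp) (auto simp: inj_on_def)
  have "AE x in unif. x \<in> {0..1::real}"
    by (rule AE_uniform_measureI) auto
  then show "AE x in cube n. \<forall>i\<in>{1..n}. x i \<in> {0..1}"
    by (intro AE_finite_allI AE_PiM_component prob_space_unif) auto
qed

text \<open>The factors are identical, so relabelling coordinates preserves the product measure. The
  restriction to \<open>{1..n}\<close> keeps the relabelled point extensional, hence in the product
  space.\<close>

lemma cube_permute:
  assumes s: "s permutes {1..n}" and E: "{x \<in> space (cube n). Q x} \<in> sets (cube n)"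
  shows "{x \<in> space (cube n). Q (\<lambda>i\<in>{1..n}. x (s i))} \<in> sets (cube n)"
    and "measure (cube n) {x \<in> space (cube n). Q (\<lambda>i\<in>{1..n}. x (s i))} =
      measure (cube n) {x \<in> space (cube n). Q x}"
proof -
  let ?t = "\<lambda>x. \<lambda>i\<in>{1..n}. x (s i)"
  have s_in: "s i \<in> {1..n}" if "i \<in> {1..n}" for i
    using that permutes_in_image[OF s] by blast
  have t: "?t \<in> measurable (cube n) (cube n)"
    using s_in by (intro measurable_restrict measurable_component_singleton)
  have eq: "{x \<in> space (cube n). Q (?t x)} = ?t -` {x \<in> space (cube n). Q x} \<inter> space (cube n)"
    using measurable_space[OF t] by auto
  show "{x \<in> space (cube n). Q (?t x)} \<in> sets (cube n)"
    unfolding eq using t E by (rule measurable_sets)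
  have "distr (cube n) (cube n) ?t = cube n"
    using distr_PiM_reindex[of "{1..n}" "\<lambda>_. unif" s "{1..n}"] s_in permutes_inj_on[OF s] prob_space_unif
    by auto
  then show "measure (cube n) {x \<in> space (cube n). Q (?t x)} = measure (cube n) {x \<in> space (cube n). Q x}"
    unfolding eq using measure_distr[OF t E] by simp
qed

text \<open>Up to a null set the event is the disjoint union, over all permutations
  \<open>s\<close>, of the sets \<open>E s\<close> of points that \<open>s\<close> sorts into the
  cone. Each has measure \<open>p\<close>, and the \<open>fact n\<close> permutations cancel the
  factorial in \<open>p\<close>.\<close>

lemma measure_no_polygon:
  assumes k: "2 \<le> k" and n: "k \<le> n"
  shows "measure (cube n) {x \<in> space (cube n). no_polygon k n x} = 1 / (\<Prod>j\<in>{1..n}. weight k n j)"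
proof -
  interpret prob_space "cube n" by (rule prob_space_cube)
  define Q where "Q x \<longleftrightarrow> cone (coeffs k n) 0 n x \<and> x 1 \<le> 1" for x
  define p where "p = 1 / (fact n * (\<Prod>j\<in>{1..n}. weight k n j))"
  \<comment> \<open>\<open>D\<close> collects the almost sure properties under which a unique
    sorting permutation exists and the entries are bounded.\<close>
  define D where "D x \<longleftrightarrow> inj_on x {1..n} \<and> (\<forall>i\<in>{1..n}. x i \<in> {0..1})" for x :: "nat \<Rightarrow> real"
  define E where "E s = {x \<in> space (cube n). Q (\<lambda>i\<in>{1..n}. x (s i))}" for s
  let ?S = "{s. s permutes {1..n}}"
  have Q_cong: "Q (\<lambda>i\<in>{1..n}. x (s i)) \<longleftrightarrow> Q (x \<circ> s)" for x s
    using cone_cong[of 0 n "\<lambda>i\<in>{1..n}. x (s i)" "x \<circ> s" "coeffs k n"] k n by (simp add: Q_def)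
  have Qm: "{x \<in> space (cube n). Q x} \<in> sets (cube n)"
    unfolding Q_def using k n
    by (intro sets.sets_Collect_conj cone_measurable[unfolded pred_def] borel_measurable_le
        borel_measurable_const borel_measurable_component_unif) auto
  have Em: "E s \<in> sets (cube n)" if "s \<in> ?S" for s
    unfolding E_def using cube_permute(1)[OF _ Qm] that by simp
  have w: "1 \<le> weight k n j" if "j \<in> {1..n}" for j
    using weight_ge_1[OF k n that] .
  have "0 < (\<Prod>j\<in>{1..n}. weight k n j)"
    using w by (intro prod_pos) (auto intro: less_le_trans[OF zero_less_one])
  then have p0: "0 \<le> p" by (simp add: p_def)
  have Ep: "measure (cube n) (E s) = p" if "s \<in> ?S" for s
  proof -
    have "emeasure (cube n) {x \<in> space (cube n). Q x} = ennreal p"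
      unfolding Q_def p_def using k n w weight_rec[OF k n]
      by (intro emeasure_cone) (auto simp: coeffs_def)
    then have "measure (cube n) {x \<in> space (cube n). Q x} = p"
      using p0 by (simp add: measure_def)
    then show ?thesis
      unfolding E_def using cube_permute(2)[OF _ Qm] that by simp
  qed
  have sort: "no_polygon k n x \<longleftrightarrow> (\<exists>s\<in>?S. Q (x \<circ> s))" if D: "D x" for x
  proof
    assume np: "no_polygon k n x"
    obtain s where s: "s permutes {1..n}" "antimono_on {1..n} (x \<circ> s)"
      using ex1_sorting_permutation[of x n] D unfolding D_def by blast
    have sin: "s i \<in> {1..n}" if "i \<in> {1..n}" for i
      using that permutes_in_image[OF s(1)] by blast
    have "cone (coeffs k n) 0 n (x \<circ> s)"
      using no_polygon_iff_cone[of k n "x \<circ> s"] k n s no_polygon_permute[OF s(1), of k x] np D sin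
      by (auto simp: D_def)
    moreover have "(x \<circ> s) 1 \<le> 1"
      using D sin[of 1] k n by (auto simp: D_def)
    ultimately show "\<exists>s\<in>?S. Q (x \<circ> s)"
      using s(1) by (auto simp: Q_def)
  next
    assume "\<exists>s\<in>?S. Q (x \<circ> s)"
    then obtain s where s: "s permutes {1..n}" "cone (coeffs k n) 0 n (x \<circ> s)"
      by (auto simp: Q_def)
    have nn: "0 \<le> (x \<circ> s) j" if "j \<in> {1..n}" for j
      using cone_nonneg[OF s(2)] that by (auto simp: coeffs_def)
    have "antimono_on {1..n} (x \<circ> s)"
      using cone_antimono[OF _ n s(2)] k by simp
    then have "no_polygon k n (x \<circ> s)"
      using no_polygon_iff_cone[of k n "x \<circ> s"] k n s(2) nn by simp
    then show "no_polygon k n x"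
      using no_polygon_permute[OF s(1)] by simp
  qed
  \<comment> \<open>Points of the cone are decreasing, so both permutations sort the same injective
    sequence.\<close>
  have uniq: "s = t" if "D x" "s \<in> ?S" "t \<in> ?S" "Q (x \<circ> s)" "Q (x \<circ> t)" for x s t
  proof -
    have "antimono_on {1..n} (x \<circ> s)" "antimono_on {1..n} (x \<circ> t)"
      using that(4,5) cone_antimono[OF _ n] k by (simp_all add: Q_def)
    then show ?thesis
      using ex1_sorting_permutation[of x n] that(1-3) unfolding D_def by blast
  qed
  have AED: "AE x in cube n. D x"
    using AE_cube by (simp add: D_def)
  have disj: "pairwise (\<lambda>s t. AE x in cube n. x \<notin> E s \<or> x \<notin> E t) ?S"
  proof (rule pairwiseI)
    fix s t assume st: "s \<in> ?S" "t \<in> ?S" "s \<noteq> t"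
    have "x \<notin> E s \<or> x \<notin> E t" if "D x" for x
      using uniq[OF that st(1,2)] st(3) unfolding E_def mem_Collect_eq Q_cong by blast
    then show "AE x in cube n. x \<notin> E s \<or> x \<notin> E t"
      using AED by (auto elim: eventually_mono)
  qed
  have "measure (cube n) {x \<in> space (cube n). no_polygon k n x} = measure (cube n) (\<Union>s\<in>?S. E s)"
  proof (rule finite_measure_eq_AE)
    show "AE x in cube n. x \<in> {x \<in> space (cube n). no_polygon k n x} \<longleftrightarrow> x \<in> (\<Union>s\<in>?S. E s)"
    proof -
      have "x \<in> {x \<in> space (cube n). no_polygon k n x} \<longleftrightarrow> x \<in> (\<Union>s\<in>?S. E s)" if "D x" for x
        by (simp only: UN_iff E_def mem_Collect_eq Q_cong sort[OF that]) blast
      then show ?thesis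
        using AED by (auto elim: eventually_mono)
    qed
    show "{x \<in> space (cube n). no_polygon k n x} \<in> sets (cube n)"
      using no_polygon_measurable by (simp add: pred_def)
    show "(\<Union>s\<in>?S. E s) \<in> sets (cube n)"
      using Em by (intro sets.finite_UN finite_permutations) auto
  qed
  also have "\<dots> = (\<Sum>s\<in>?S. measure (cube n) (E s))"
    using Em disj by (intro measure_UNION_AE finite_permutations)
      (simp_all only: fmeasurable_eq_sets finite_atLeastAtMost)
  also have "\<dots> = real (card ?S) * p"
    using Ep by simp
  also have "card ?S = fact n"
    by (rule card_permutations) auto
  finally show ?thesis by (simp add: p_def)
qed

theorem theorem1:
  fixes M :: "'a measure" and U :: "nat \<Rightarrow> 'a \<Rightarrow> real" and k n :: nat
  assumes "k \<ge> 3" and "n \<ge> k"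
    and "prob_space M"
    and "prob_space.indep_vars M (\<lambda>_. borel) U {1..n}"
    and "\<And>i. i \<in> {1..n} \<Longrightarrow> distr M borel (U i) = uniform_measure lborel {0..1}"
  shows "measure M {\<omega> \<in> space M.
             \<forall>I. I \<subseteq> {1..n} \<and> card I = k + 1 \<longrightarrow> \<not> can_form_polygon (\<lambda>i. U i \<omega>) I}
         = (\<Prod>l\<in>{1..n - k + 2}. 1 / real (kfib k (int l))) *
           (\<Prod>i\<in>{1..k - 2}.
              1 / (real (kfib k (int n - int i + 1)) -
                   (\<Sum>j\<in>{1..k - i - 1}.
                      (real k - real i - real j) * real (kfib k (int n - int k + int j)))))"
proof -
  interpret prob_space M by fact
  have n: "{1..n} \<noteq> {}" and k: "2 \<le> k"
    using assms(1,2) by auto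
  have rv: "random_variable borel (U i)" if "i \<in> {1..n}" for i
    using assms(4) that by (auto simp: indep_vars_def)
  let ?B = "PiM {1..n} (\<lambda>_. borel)"
  let ?X = "\<lambda>\<omega>. \<lambda>i\<in>{1..n}. U i \<omega>"
  let ?E = "{x \<in> space (cube n). no_polygon k n x}"
  \<comment> \<open>Independence turns the joint law into the product of the marginal laws, so the
    event can be measured in \<open>cube n\<close>.\<close>
  have "distr M ?B ?X = PiM {1..n} (\<lambda>i. distr M borel (U i))"
    using indep_vars_iff_distr_eq_PiM'[where M' = "\<lambda>_. borel" and X = U, OF n rv] assms(4) by blast
  also have "\<dots> = cube n"
    using assms(5) by (intro PiM_cong) auto
  finally have distr: "distr M ?B ?X = cube n" .
  have X: "?X \<in> measurable M ?B"
    using rv by (intro measurable_restrict)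
  have "?E \<in> sets (distr M ?B ?X)"
    using no_polygon_measurable[of k n] unfolding distr pred_def .
  then have E: "?E \<in> sets ?B" by simp
  have "space (cube n) = space ?B"
    using distr by (metis space_distr)
  then have "?X -` ?E \<inter> space M = {\<omega> \<in> space M. no_polygon k n (?X \<omega>)}"
    using measurable_space[OF X] by auto
  also have "\<dots> = {\<omega> \<in> space M. no_polygon k n (\<lambda>i. U i \<omega>)}"
    using no_polygon_cong[of n "?X \<omega>" "\<lambda>i. U i \<omega>" k for \<omega>] by simp
  finally have vimage: "?X -` ?E \<inter> space M = {\<omega> \<in> space M. no_polygon k n (\<lambda>i. U i \<omega>)}" .
  have "measure M {\<omega> \<in> space M. no_polygon k n (\<lambda>i. U i \<omega>)} = measure (cube n) ?E"
    using measure_distr[OF X E] by (simp only: distr vimage)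
  also have "\<dots> = 1 / (\<Prod>j\<in>{1..n}. weight k n j)"
    by (rule measure_no_polygon[OF k assms(2)])
  finally show ?thesis
    unfolding prod_weight[OF k assms(2)] no_polygon_def .
qed

end
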